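(* Let $\sigma=\sigma_1\sigma_2\cdots\sigma_k$ be a Cayley permutation of length $k\ge 2$. Then $\sigma$ is fully bijective, i.e. the map $\mathcal{S}^{\sigma}:\mathrm{Cay}\to\mathrm{Cay}$ is bijective, if and only if $\sigma_1=\sigma_2$.
   Context: A Cayley permutation is a word $x_1\cdots x_n$ of positive integers containing at least one copy of each integer from $1$ to its maximum value; $\mathrm{Cay}$ is the set of Cayley permutations. A word $x$ contains a pattern $y=y_1\cdots y_k$ if it has a subsequence $x_{i_1}\cdots x_{i_k}$ ($i_1<\dots<i_k$) such that for all $s,t$: $x_{i_s}<x_{i_t}$ iff $y_s<y_t$, and $x_{i_s}=x_{i_t}$ iff $y_s=y_t$. For a Cayley permutation $\sigma$ of length at least $2$, the $\sigma$-stack acts on an input $\pi=\pi_1\cdots\pi_n\in\mathrm{Cay}$ as follows (starting with empty stack and output). For $i=1,\dots,n$: as long as pushing $\pi_i$ on top of the stack would make the content of the stack, read from top to bottom, contain an occurrence of $\sigma$, pop the top element and append it to the output; then push $\pi_i$. After all letters have been pushed, pop all remaining elements, from top to bottom, appending them to the output. The resulting output is denoted $\mathcal{S}^{\sigma}(\pi)$. *)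

theory Defs
  imports "HOL-Library.Sublist"
begin

text \<open>The empty word counts as a Cayley permutation; it is treated separately because
  \<^term>\<open>Max {}\<close> is unspecified.\<close>

definition Cay :: "nat list set" where
  "Cay = {w. w = [] \<or> set w = {1..Max (set w)}}"

definition order_iso :: "nat list \<Rightarrow> nat list \<Rightarrow> bool" where
  "order_iso z y \<longleftrightarrow> length z = length y \<and>
     (\<forall>s<length y. \<forall>t<length y. (z ! s < z ! t \<longleftrightarrow> y ! s < y ! t) \<and> (z ! s = z ! t \<longleftrightarrow> y ! s = y ! t))"

definition contains :: "nat list \<Rightarrow> nat list \<Rightarrow> bool" where
  "contains x y \<longleftrightarrow> (\<exists>z. subseq z x \<and> order_iso z y)"

text \<open>A state is a pair of stack and output. The stack is listed from top to bottom, so its head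
  is the top element; the output is listed in the order in which letters were emitted. Pushing onto
  the empty stack is unconditional: one letter cannot contain a pattern of length at least 2.\<close>

fun insert_letter :: "nat list \<Rightarrow> nat \<Rightarrow> nat list \<times> nat list \<Rightarrow> nat list \<times> nat list" where
  "insert_letter \<sigma> a ([], out) = ([a], out)"
| "insert_letter \<sigma> a (b # st, out) =
     (if contains (a # b # st) \<sigma> then insert_letter \<sigma> a (st, out @ [b])
      else (a # b # st, out))"

definition stack_map :: "nat list \<Rightarrow> nat list \<Rightarrow> nat list" where
  "stack_map \<sigma> \<pi> = (case fold (insert_letter \<sigma>) \<pi> ([], []) of (st, out) \<Rightarrow> out @ st)"

definition fully_bijective :: "nat list \<Rightarrow> bool" where
  "fully_bijective \<sigma> \<longleftrightarrow> bij_betw (stack_map \<sigma>) Cay Cay"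

end

theory Submission
  imports Defs
begin

text \<open>
  Write \<open>S\<close> for the map of the \<open>\<sigma>\<close>-stack and \<open>R\<close> for the reversal of words. Since \<open>S\<close> only
  permutes letters, it maps Cayley permutations to Cayley permutations.

  If \<open>\<sigma>\<^sub>1 = \<sigma>\<^sub>2\<close>, then running the machine backwards in time is again a run of the machine, so that
  \<open>R \<circ> S\<close> is an involution and \<open>S\<close> is bijective with inverse \<open>R \<circ> S \<circ> R\<close>.
  Backwards in time, pops are pushes and pushes are pops, and the stack passes through the same
  contents, none of which contains \<open>\<sigma>\<close>; so every backward push is permitted. It remains to see
  that every backward pop is forced. Suppose that the machine pops \<open>d\<close>, leaving the stack \<open>s\<close>,
  and pushes \<open>a\<close> onto \<open>s\<close> right after. Then \<open>a d s\<close> contains \<open>\<sigma>\<close> whereas \<open>a s\<close> and \<open>d s\<close> do not, so the occurrence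
  uses \<open>a\<close> and \<open>d\<close> as its first two letters, and \<open>\<sigma>\<^sub>1 = \<sigma>\<^sub>2\<close> gives \<open>a = d\<close>
  (\<open>forced_pop_same_letter\<close>). Thus \<open>a\<close> and \<open>d\<close> can be exchanged: backwards in time, \<open>d\<close> cannot be
  pushed as long as \<open>a\<close> is on the stack, and this stays true when other letters lie above \<open>a\<close>.
  Lemma \<open>run_reversed\<close> carries this out.

  If \<open>\<sigma>\<^sub>1 \<noteq> \<sigma>\<^sub>2\<close>, let \<open>\<sigma>'\<close> be \<open>\<sigma>\<close> with its first two letters exchanged. The input \<open>R \<sigma>'\<close> is pushed
  entirely and comes out as \<open>\<sigma>'\<close>. On input \<open>R \<sigma>\<close> only the last push is blocked; it
  makes \<open>\<sigma>\<^sub>2\<close> leave before \<open>\<sigma>\<^sub>1\<close>, so that the output is \<open>\<sigma>'\<close> once more, and \<open>S\<close> is not injective.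
\<close>

section \<open>Pattern containment\<close>

lemma contains_mono: "contains x y \<Longrightarrow> subseq x x' \<Longrightarrow> contains x' y"
  unfolding contains_def using subseq_order.order_trans by blast

lemma contains_length: "contains x y \<Longrightarrow> length y \<le> length x"
  unfolding contains_def order_iso_def by (auto dest: list_emb_length)

lemma contains_refl: "contains x x"
  unfolding contains_def order_iso_def by blast

lemma contains_same_length:
  assumes "contains x y" and "length x = length y"
  shows "order_iso x y"
  using assms unfolding contains_def order_iso_def by (metis subseq_same_length)

lemma forced_pop_same_letter:
  assumes eq: "\<sigma> ! 0 = \<sigma> ! 1" and len: "2 \<le> length \<sigma>"
    and occ: "contains (a # b # st) \<sigma>"
    and "\<not> contains (a # st) \<sigma>" and "\<not> contains (b # st) \<sigma>"
  shows "a = b"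
proof -
  obtain z where z: "subseq z (a # b # st)" and iso: "order_iso z \<sigma>"
    using occ unfolding contains_def by blast
  have "\<not> subseq z (a # st)" "\<not> subseq z (b # st)"
    using assms(4,5) iso unfolding contains_def by blast+
  then obtain z' where "z = a # b # z'"
    using z by (cases z; cases "tl z") (auto split: if_splits)
  moreover have "z ! 0 = z ! 1"
    using iso eq len unfolding order_iso_def
    by (metis Suc_1 Suc_le_lessD less_trans zero_less_one One_nat_def)
  ultimately show ?thesis by simp
qed

section \<open>The machine as a sequence of single pushes and pops\<close>

text \<open>The output still to be emitted, given the stack and the remaining input. In contrast to
  \<^const>\<open>insert_letter\<close>, every recursive call is one push or one pop, and the final emptying of the
  stack consists of pops like any others; a run can then be read backwards step by step.\<close>

function run :: "nat list \<Rightarrow> nat list \<Rightarrow> nat list \<Rightarrow> nat list" where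
  "run \<sigma> [] [] = []"
| "run \<sigma> (b # st) [] = b # run \<sigma> st []"
| "run \<sigma> [] (a # xs) = run \<sigma> [a] xs"
| "run \<sigma> (b # st) (a # xs) =
     (if contains (a # b # st) \<sigma> then b # run \<sigma> st (a # xs) else run \<sigma> (a # b # st) xs)"
  by pat_completeness auto
termination
  \<comment> \<open>A letter of the input is pushed once and popped once, hence the weight 2.\<close>
  by (relation "measure (\<lambda>(\<sigma>, st, xs). length st + 2 * length xs)") auto

lemma run_empty_input [simp]: "run \<sigma> st [] = st"
  by (induction st) auto

lemma fold_insert_letter_run:
  "(case fold (insert_letter \<sigma>) xs (st, out) of (st', out') \<Rightarrow> out' @ st') = out @ run \<sigma> st xs"
  by (induction \<sigma> st xs arbitrary: out rule: run.induct) auto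

lemma stack_map_run: "stack_map \<sigma> xs = run \<sigma> [] xs"
  using fold_insert_letter_run[of \<sigma> xs "[]" "[]"] by (simp add: stack_map_def)

lemma set_run: "set (run \<sigma> st xs) = set st \<union> set xs"
  by (induction \<sigma> st xs rule: run.induct) auto

lemma run_push: "\<not> contains (a # st) \<sigma> \<Longrightarrow> run \<sigma> st (a # xs) = run \<sigma> (a # st) xs"
  by (cases st) auto

lemma run_push_all:
  "\<not> contains (rev xs @ st) \<sigma> \<Longrightarrow> run \<sigma> st (xs @ ys) = run \<sigma> (rev xs @ st) ys"
proof (induction xs arbitrary: st)
  case (Cons a xs)
  have "\<not> contains (a # st) \<sigma>"
    using Cons.prems contains_mono[of "a # st" \<sigma> "rev xs @ a # st"] by auto
  then show ?case
    using Cons by (simp add: run_push)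
qed simp

lemma Cay_set_cong:
  assumes "set v = set w"
  shows "v \<in> Cay \<longleftrightarrow> w \<in> Cay"
proof -
  have "v = [] \<longleftrightarrow> w = []"
    using assms by (metis set_empty)
  then show ?thesis
    using assms by (simp add: Cay_def)
qed

lemma stack_map_Cay: "stack_map \<sigma> xs \<in> Cay \<longleftrightarrow> xs \<in> Cay"
  by (rule Cay_set_cong) (simp add: stack_map_run set_run)

lemma rev_Cay: "rev xs \<in> Cay \<longleftrightarrow> xs \<in> Cay"
  by (rule Cay_set_cong) simp

section \<open>Reversing time when the first two letters of the pattern agree\<close>

text \<open>A configuration consists of the stack \<open>st\<close>, the remaining input \<open>xs\<close> and the output \<open>out\<close>
  emitted so far, listed with the most recent letter first. Reversing time exchanges \<open>xs\<close> and
  \<open>out\<close>. On the left is the complete (reversed) outcome of the time-reversed configuration, on the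
  right the outcome of the machine fed with the reversal of the complete output. Both agree because
  each step of the run, read backwards, is a legitimate step of the machine.

  The hypothesis \<open>inv\<close> is the invariant of the forward run that makes backward pops forced: if the
  next step is to push \<open>a\<close>, then the letter \<open>d\<close> popped last cannot be pushed on top of \<open>a\<close>.\<close>

lemma run_reversed:
  assumes eq: "\<sigma> ! 0 = \<sigma> ! 1" and len: "2 \<le> length \<sigma>"
    and "\<not> contains st \<sigma>"
    and inv: "\<And>d out' a xs'. out = d # out' \<Longrightarrow> xs = a # xs' \<Longrightarrow>
      \<not> contains (a # st) \<sigma> \<Longrightarrow> contains (d # a # st) \<sigma>"
  shows "rev xs @ run \<sigma> st out = run \<sigma> [] (rev (run \<sigma> st xs) @ out)"
  using assms
proof (induction \<sigma> st xs arbitrary: out rule: run.induct)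
  case (1 \<sigma>)
  then show ?case by simp
next
  case (2 \<sigma> b st)
  have "\<not> contains st \<sigma>"
    using 2(4) contains_mono[of st \<sigma> "b # st"] by auto
  then have "run \<sigma> st (b # out) = run \<sigma> [] (rev (run \<sigma> st []) @ b # out)"
    using 2(1)[of "b # out"] 2(2,3) by simp
  then show ?case
    using run_push[OF 2(4), of out] by simp
next
  case (3 \<sigma> a xs)
  have short: "\<not> contains [a] \<sigma>"
    using 3(3) contains_length[of "[a]" \<sigma>] by auto
  have blocked: "contains [d, a] \<sigma>" if "out = d # out'" for d out'
    using 3(5)[OF that refl] short by simp
  have "rev xs @ run \<sigma> [a] out = run \<sigma> [] (rev (run \<sigma> [a] xs) @ out)"
  proof (rule 3(1))
    fix d out' c xs'
    assume "out = d # out'"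
    then show "contains (d # c # [a]) \<sigma>"
      using blocked contains_mono[of "[d, a]" \<sigma> "[d, c, a]"] by auto
  qed (use 3 short in auto)
  moreover have "run \<sigma> [a] out = a # run \<sigma> [] out"
    using blocked by (cases out) auto
  ultimately show ?case by simp
next
  case (4 \<sigma> b st a xs)
  show ?case
  proof (cases "contains (a # b # st) \<sigma>")
    case pop: True
    have "\<not> contains st \<sigma>"
      using 4(5) contains_mono[of st \<sigma> "b # st"] by auto
    then have "rev (a # xs) @ run \<sigma> st (b # out)
        = run \<sigma> [] (rev (run \<sigma> st (a # xs)) @ b # out)"
    proof (rule 4(1)[OF pop 4(3,4)])
      fix d out' c xs'
      assume "b # out = d # out'" "a # xs = c # xs'" "\<not> contains (c # st) \<sigma>"
      then show "contains (d # c # st) \<sigma>"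
        \<comment> \<open>The letters \<open>c\<close> and \<open>d\<close> are equal, so they may be exchanged.\<close>
        using forced_pop_same_letter[OF 4(3,4) pop _ 4(5)] pop by auto
    qed
    then show ?thesis
      using pop run_push[OF 4(5), of out] by simp
  next
    case push: False
    have blocked: "contains (d # a # b # st) \<sigma>" if "out = d # out'" for d out'
      using 4(6)[OF that refl push] .
    have "rev xs @ run \<sigma> (a # b # st) out = run \<sigma> [] (rev (run \<sigma> (a # b # st) xs) @ out)"
    proof (rule 4(2)[OF push 4(3,4) push])
      fix d out' c xs'
      assume out: "out = d # out'"
      have "subseq (a # b # st) (c # a # b # st)"
        by (rule list_emb_Cons) simp
      then show "contains (d # c # a # b # st) \<sigma>"
        by (intro contains_mono[OF blocked[OF out]]) simp
    qed
    moreover have "run \<sigma> (a # b # st) out = a # run \<sigma> (b # st) out"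
      using blocked by (cases out) auto
    ultimately show ?thesis
      using push by simp
  qed
qed

lemma stack_map_rev_stack_map:
  assumes "\<sigma> ! 0 = \<sigma> ! 1" and "2 \<le> length \<sigma>"
  shows "stack_map \<sigma> (rev (stack_map \<sigma> xs)) = rev xs"
proof -
  have "\<not> contains [] \<sigma>"
    using assms(2) contains_length[of "[]" \<sigma>] by auto
  then show ?thesis
    using run_reversed[OF assms, of "[]" "[]" xs] by (simp add: stack_map_run)
qed

section \<open>A collision when the first two letters of the pattern differ\<close>

lemma stack_map_rev_pattern: "stack_map (x # y # \<tau>) (rev (x # y # \<tau>)) = y # x # \<tau>"
proof -
  let ?\<sigma> = "x # y # \<tau>"
  have short: "\<not> contains (c # \<tau>) ?\<sigma>" for c
    using contains_length[of "c # \<tau>" ?\<sigma>] by auto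
  have "run ?\<sigma> [] (rev ?\<sigma>) = run ?\<sigma> (y # \<tau>) [x]"
    using run_push_all[of "rev (y # \<tau>)" "[]" ?\<sigma> "[x]"] short by simp
  also have "\<dots> = y # run ?\<sigma> \<tau> [x]"
    by (simp add: contains_refl)
  also have "\<dots> = y # x # \<tau>"
    using run_push[OF short, of x "[]"] by simp
  finally show ?thesis
    by (simp add: stack_map_run)
qed

lemma stack_map_rev_swapped_pattern:
  assumes "x \<noteq> y"
  shows "stack_map (x # y # \<tau>) (rev (y # x # \<tau>)) = y # x # \<tau>"
proof -
  let ?\<sigma> = "x # y # \<tau>" and ?\<sigma>' = "y # x # \<tau>"
  have "\<not> order_iso ?\<sigma>' ?\<sigma>"
  proof
    assume "order_iso ?\<sigma>' ?\<sigma>"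
    then have "?\<sigma>' ! 0 < ?\<sigma>' ! 1 \<longleftrightarrow> ?\<sigma> ! 0 < ?\<sigma> ! 1"
      unfolding order_iso_def by fastforce
    then show False
      using assms by auto
  qed
  then have "\<not> contains ?\<sigma>' ?\<sigma>"
    using contains_same_length[of ?\<sigma>' ?\<sigma>] by auto
  then show ?thesis
    using run_push_all[of "rev ?\<sigma>'" "[]" ?\<sigma> "[]"] by (simp add: stack_map_run)
qed

section \<open>The characterisation of fully bijective patterns\<close>

theorem theorem8p12:
  fixes \<sigma> :: "nat list"
  assumes "\<sigma> \<in> Cay" and "length \<sigma> \<ge> 2"
  shows "fully_bijective \<sigma> \<longleftrightarrow> \<sigma> ! 0 = \<sigma> ! 1"
proof
  assume bij: "fully_bijective \<sigma>"
  obtain x y \<tau> where \<sigma>: "\<sigma> = x # y # \<tau>"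
    using assms(2) by (cases \<sigma>; cases "tl \<sigma>") auto
  have "x = y"
  proof (rule ccontr)
    assume "x \<noteq> y"
    then have "stack_map \<sigma> (rev (y # x # \<tau>)) = stack_map \<sigma> (rev \<sigma>)"
      using stack_map_rev_pattern stack_map_rev_swapped_pattern unfolding \<sigma> by metis
    moreover have "rev \<sigma> \<in> Cay"
      using assms(1) by (simp only: rev_Cay)
    moreover have "rev (y # x # \<tau>) \<in> Cay"
      using assms(1) Cay_set_cong[of "rev (y # x # \<tau>)" \<sigma>] unfolding \<sigma> by auto
    ultimately have "rev (y # x # \<tau>) = rev \<sigma>"
      using bij unfolding fully_bijective_def bij_betw_def by (meson inj_onD)
    then show False
      using \<open>x \<noteq> y\<close> unfolding \<sigma> by simp
  qed
  then show "\<sigma> ! 0 = \<sigma> ! 1"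
    unfolding \<sigma> by simp
next
  assume eq: "\<sigma> ! 0 = \<sigma> ! 1"
  show "fully_bijective \<sigma>"
    unfolding fully_bijective_def
    by (rule bij_betw_byWitness[where f' = "\<lambda>w. rev (stack_map \<sigma> (rev w))"])
      (auto simp: stack_map_rev_stack_map[OF eq assms(2)] stack_map_Cay rev_Cay)
qed

end
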